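(* Let $\Gamma=(V,E,o,t)$ be a connected, locally finite, countable graph. Then the Abel--Jacobi map $\widetilde{\mathrm{AJ}}\colon \mathbb{Z}[V]_0\to \mathrm{J}(\Gamma)$ is surjective with kernel $\mathrm{Prin}(\Gamma)=\Delta_0(\mathbb{Z}[V])$; hence it induces an isomorphism $\mathrm{AJ}\colon \mathrm{Cl}^0(\Gamma)=\mathbb{Z}[V]_0/\mathrm{Prin}(\Gamma)\xrightarrow{\sim}\mathrm{J}(\Gamma)$.
   Context: A graph $\Gamma=(V,E,o,t)$ consists of sets $V\neq\emptyset$ (vertices), $E$ (edges) and maps $o,t\colon E\to V$ (origin, terminus); loops and multiple edges are allowed. Locally finite means all fibres of $o$ and $t$ are finite. Chains: $C_0=\mathbb{Z}[V]$, $C_1=\mathbb{Z}[E]$, $\partial=t-o\colon C_1\to C_0$; $H_1(\Gamma)=\ker\partial$. Cochains: $C^0=\mathbb{Z}^V$, $C^1=\mathbb{Z}^E$, $(df)(e)=f(t(e))-f(o(e))$. Define $\partial^*\colon C_0\to C_1$, $\partial^*(v)=\sum_{t(e)=v}e-\sum_{o(e)=v}e$, and $d^*\colon\mathbb{Z}^E\to\mathbb{Z}^V$ its transpose, $(d^*\omega)(v)=\sum_{t(e)=v}\omega(e)-\sum_{o(e)=v}\omega(e)$. Set $\Delta_0=\partial\partial^*\colon\mathbb{Z}[V]\to\mathbb{Z}[V]$. Harmonic 1-cochains: $\mathcal{H}^1(\Gamma)=\ker d^*\subset\mathbb{Z}^E$. For an abelian group $M$, $M^\vee=\mathrm{Hom}(M,\mathbb{Z})$.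 Let $\alpha\colon H_1(\Gamma)\to\mathcal{H}^1(\Gamma)^\vee$, $\gamma\mapsto(\omega\mapsto\omega(\gamma))$. The Jacobian is $\mathrm{J}(\Gamma)=\mathcal{H}^1(\Gamma)^\vee/\alpha(H_1(\Gamma))$. For $D\in\mathbb{Z}[V]_0$ (divisors of degree $0$) choose $\gamma_D\in C_1$ with $\partial\gamma_D=D$; $\widetilde{\mathrm{AJ}}(D)$ is the class of $\omega\mapsto\omega(\gamma_D)$ modulo $\alpha(H_1(\Gamma))$. *)

theory Defs
  imports
    "HOL-Library.Countable_Set"
    "HOL-Algebra.Coset"
    "HOL-Algebra.Product_Groups"
    "HOL-Algebra.Free_Abelian_Groups"
    "Graph_Theory.Digraph"
    "Graph_Theory.Digraph_Component"
begin

text \<open>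
  A graph \<open>(V, E, o, t)\<close> is a \<^const>\<open>wf_digraph\<close>: \<open>V = verts G\<close>, \<open>E = arcs G\<close>, \<open>o = tail G\<close>,
  \<open>t = head G\<close>. Loops and parallel arcs are allowed. The requirement that \<open>V\<close> is nonempty
  is part of \<^const>\<open>Digraph_Component.connected\<close>, which is connectedness of the underlying
  undirected graph.
\<close>

definition locally_finite :: "('v, 'e) pre_digraph \<Rightarrow> bool" where
  "locally_finite G \<longleftrightarrow> (\<forall>v\<in>verts G. finite (out_arcs G v) \<and> finite (in_arcs G v))"


subsection \<open>Chains and cochains\<close>

abbreviation chains0 :: "('v, 'e) pre_digraph \<Rightarrow> ('v \<Rightarrow>\<^sub>0 int) monoid" where
  "chains0 G \<equiv> free_Abelian_group (verts G)"

abbreviation chains1 :: "('v, 'e) pre_digraph \<Rightarrow> ('e \<Rightarrow>\<^sub>0 int) monoid" where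
  "chains1 G \<equiv> free_Abelian_group (arcs G)"

abbreviation cochains0 :: "('v, 'e) pre_digraph \<Rightarrow> ('v \<Rightarrow> int) monoid" where
  "cochains0 G \<equiv> product_group (verts G) (\<lambda>_. integer_group)"

abbreviation cochains1 :: "('v, 'e) pre_digraph \<Rightarrow> ('e \<Rightarrow> int) monoid" where
  "cochains1 G \<equiv> product_group (arcs G) (\<lambda>_. integer_group)"

definition bdry :: "('v, 'e) pre_digraph \<Rightarrow> ('e \<Rightarrow>\<^sub>0 int) \<Rightarrow> ('v \<Rightarrow>\<^sub>0 int)" where
  "bdry G = frag_extend (\<lambda>e. frag_of (head G e) - frag_of (tail G e))"

definition bdry_star :: "('v, 'e) pre_digraph \<Rightarrow> ('v \<Rightarrow>\<^sub>0 int) \<Rightarrow> ('e \<Rightarrow>\<^sub>0 int)" where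
  "bdry_star G =
     frag_extend (\<lambda>v. (\<Sum>e\<in>in_arcs G v. frag_of e) - (\<Sum>e\<in>out_arcs G v. frag_of e))"

definition d_star :: "('v, 'e) pre_digraph \<Rightarrow> ('e \<Rightarrow> int) \<Rightarrow> ('v \<Rightarrow> int)" where
  "d_star G \<omega> = (\<lambda>v\<in>verts G. (\<Sum>e\<in>in_arcs G v. \<omega> e) - (\<Sum>e\<in>out_arcs G v. \<omega> e))"

definition laplacian0 :: "('v, 'e) pre_digraph \<Rightarrow> ('v \<Rightarrow>\<^sub>0 int) \<Rightarrow> ('v \<Rightarrow>\<^sub>0 int)" where
  "laplacian0 G = bdry G \<circ> bdry_star G"

definition H1 :: "('v, 'e) pre_digraph \<Rightarrow> ('e \<Rightarrow>\<^sub>0 int) set" where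
  "H1 G = kernel (chains1 G) (chains0 G) (bdry G)"

definition harmonic :: "('v, 'e) pre_digraph \<Rightarrow> ('e \<Rightarrow> int) monoid" where
  "harmonic G = (cochains1 G)\<lparr>carrier := kernel (cochains1 G) (cochains0 G) (d_star G)\<rparr>"

definition eval_chain :: "('e \<Rightarrow> int) \<Rightarrow> ('e \<Rightarrow>\<^sub>0 int) \<Rightarrow> int" where
  "eval_chain \<omega> \<gamma> = (\<Sum>e\<in>Poly_Mapping.keys \<gamma>. Poly_Mapping.lookup \<gamma> e * \<omega> e)"


subsection \<open>The Jacobian\<close>

text \<open>
  Homomorphisms on \<open>M\<close> are taken to be extensional, so that equality in \<open>M\<^sup>\<or>\<close> is equality
  on the carrier of \<open>M\<close>.
\<close>

definition dual_group :: "('a, 'b) monoid_scheme \<Rightarrow> ('a \<Rightarrow> int) monoid" where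
  "dual_group M =
     \<lparr>carrier = hom M integer_group \<inter> extensional (carrier M),
      monoid.mult = (\<lambda>f g. \<lambda>x\<in>carrier M. f x + g x),
      one = (\<lambda>x\<in>carrier M. 0)\<rparr>"

definition integration :: "('v, 'e) pre_digraph \<Rightarrow> ('e \<Rightarrow>\<^sub>0 int) \<Rightarrow> (('e \<Rightarrow> int) \<Rightarrow> int)" where
  "integration G \<gamma> = (\<lambda>\<omega>\<in>carrier (harmonic G). eval_chain \<omega> \<gamma>)"

text \<open>The map \<open>\<alpha>\<close> is the restriction of \<^const>\<open>integration\<close> to \<^const>\<open>H1\<close>.\<close>

definition periods :: "('v, 'e) pre_digraph \<Rightarrow> (('e \<Rightarrow> int) \<Rightarrow> int) set" where
  "periods G = integration G ` H1 G"

definition Jacobian :: "('v, 'e) pre_digraph \<Rightarrow> (('e \<Rightarrow> int) \<Rightarrow> int) set monoid" where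
  "Jacobian G = dual_group (harmonic G) Mod periods G"


subsection \<open>Divisors and the Abel--Jacobi map\<close>

definition divisor_degree :: "('v \<Rightarrow>\<^sub>0 int) \<Rightarrow> int" where
  "divisor_degree D = (\<Sum>v\<in>Poly_Mapping.keys D. Poly_Mapping.lookup D v)"

definition Div0 :: "('v, 'e) pre_digraph \<Rightarrow> ('v \<Rightarrow>\<^sub>0 int) monoid" where
  "Div0 G = (chains0 G)\<lparr>carrier := {D \<in> carrier (chains0 G). divisor_degree D = 0}\<rparr>"

definition Prin :: "('v, 'e) pre_digraph \<Rightarrow> ('v \<Rightarrow>\<^sub>0 int) set" where
  "Prin G = laplacian0 G ` carrier (chains0 G)"

definition Cl0 :: "('v, 'e) pre_digraph \<Rightarrow> ('v \<Rightarrow>\<^sub>0 int) set monoid" where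
  "Cl0 G = Div0 G Mod Prin G"

definition AJ_tilde :: "('v, 'e) pre_digraph \<Rightarrow> ('v \<Rightarrow>\<^sub>0 int) \<Rightarrow> (('e \<Rightarrow> int) \<Rightarrow> int) set" where
  "AJ_tilde G D =
     periods G #>\<^bsub>dual_group (harmonic G)\<^esub>
       integration G (SOME \<gamma>. \<gamma> \<in> carrier (chains1 G) \<and> bdry G \<gamma> = D)"

text \<open>The map induced by \<^const>\<open>AJ_tilde\<close> on cosets of \<^const>\<open>Prin\<close>.\<close>

definition AJ :: "('v, 'e) pre_digraph \<Rightarrow> ('v \<Rightarrow>\<^sub>0 int) set \<Rightarrow> (('e \<Rightarrow> int) \<Rightarrow> int) set" where
  "AJ G X = the_elem (AJ_tilde G ` X)"


subsection \<open>The Jacobian is a group and the Abel--Jacobi map is independent of choices\<close>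

lemma comm_group_dual_group:
  assumes "group M"
  shows "comm_group (dual_group M)"
proof (rule comm_groupI)
  interpret group M by fact
  show "\<exists>g\<in>carrier (dual_group M). g \<otimes>\<^bsub>dual_group M\<^esub> f = \<one>\<^bsub>dual_group M\<^esub>"
    if "f \<in> carrier (dual_group M)" for f
    by (rule bexI[of _ "\<lambda>x\<in>carrier M. - f x"])
       (use that in \<open>auto simp: dual_group_def hom_def restrict_def extensional_def fun_eq_iff\<close>)
qed (use assms in \<open>auto simp: dual_group_def hom_def restrict_def extensional_def fun_eq_iff
       group.is_monoid monoid.m_closed\<close>)

lemma eval_chain_superset:
  assumes "finite S" "Poly_Mapping.keys \<gamma> \<subseteq> S"
  shows "eval_chain \<omega> \<gamma> = (\<Sum>e\<in>S. Poly_Mapping.lookup \<gamma> e * \<omega> e)"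
  unfolding eval_chain_def
  by (rule sum.mono_neutral_left) (use assms in \<open>auto simp: in_keys_iff\<close>)

lemma eval_chain_add: "eval_chain \<omega> (\<gamma> + \<delta>) = eval_chain \<omega> \<gamma> + eval_chain \<omega> \<delta>"
proof -
  let ?S = "Poly_Mapping.keys \<gamma> \<union> Poly_Mapping.keys \<delta>"
  have "Poly_Mapping.keys (\<gamma> + \<delta>) \<subseteq> ?S"
    by (rule keys_add)
  then show ?thesis
    by (simp add: eval_chain_superset[of ?S] lookup_add distrib_right sum.distrib)
qed

lemma eval_chain_uminus: "eval_chain \<omega> (- \<gamma>) = - eval_chain \<omega> \<gamma>"
  by (simp add: eval_chain_def sum_negf)

lemma d_star_hom:
  fixes G :: "('v, 'e) pre_digraph"
  shows "d_star G \<in> hom (cochains1 G) (cochains0 G)"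
proof (rule homI)
  fix \<omega> \<eta> :: "'e \<Rightarrow> int"
  have *: "(\<Sum>e\<in>A. (\<lambda>e\<in>arcs G. \<omega> e + \<eta> e) e) = (\<Sum>e\<in>A. \<omega> e) + (\<Sum>e\<in>A. \<eta> e)"
    if "A \<subseteq> arcs G" for A
    unfolding sum.distrib[symmetric] by (rule sum.cong) (use that in auto)
  have "in_arcs G v \<subseteq> arcs G" "out_arcs G v \<subseteq> arcs G" for v
    by auto
  note this[THEN *]
  then show "d_star G (\<omega> \<otimes>\<^bsub>cochains1 G\<^esub> \<eta>) = d_star G \<omega> \<otimes>\<^bsub>cochains0 G\<^esub> d_star G \<eta>"
    unfolding d_star_def by (intro ext) (simp add: restrict_def)
qed (simp add: d_star_def)

lemma group_harmonic: "group (harmonic G)"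
proof -
  interpret group_hom "cochains1 G" "cochains0 G" "d_star G"
    by (simp add: group_hom_def group_hom_axioms_def d_star_hom)
  show ?thesis
    unfolding harmonic_def by (rule subgroup.subgroup_is_group[OF subgroup_kernel]) simp
qed

lemma integration_in_dual:
  assumes "\<gamma> \<in> carrier (chains1 G)"
  shows "integration G \<gamma> \<in> carrier (dual_group (harmonic G))"
proof -
  interpret H: group "harmonic G" by (rule group_harmonic)
  have "eval_chain (\<omega> \<otimes>\<^bsub>harmonic G\<^esub> \<eta>) \<gamma> = eval_chain \<omega> \<gamma> + eval_chain \<eta> \<gamma>" for \<omega> \<eta>
  proof -
    have "eval_chain (\<omega> \<otimes>\<^bsub>harmonic G\<^esub> \<eta>) \<gamma>
        = (\<Sum>e\<in>Poly_Mapping.keys \<gamma>. Poly_Mapping.lookup \<gamma> e * (\<omega> e + \<eta> e))"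
      unfolding eval_chain_def
      by (rule sum.cong) (use assms in \<open>auto simp: harmonic_def\<close>)
    then show ?thesis
      by (simp add: eval_chain_def distrib_left sum.distrib)
  qed
  then show ?thesis
    by (auto simp: dual_group_def integration_def hom_def)
qed

lemma integration_add:
  "integration G (\<gamma> + \<delta>) = integration G \<gamma> \<otimes>\<^bsub>dual_group (harmonic G)\<^esub> integration G \<delta>"
  by (auto simp: integration_def dual_group_def eval_chain_add fun_eq_iff)

lemma H1_iff: "\<gamma> \<in> H1 G \<longleftrightarrow> \<gamma> \<in> carrier (chains1 G) \<and> bdry G \<gamma> = 0"
  by (simp add: H1_def kernel_def)

lemma integration_hom: "integration G \<in> hom (chains1 G) (dual_group (harmonic G))"
  by (rule homI) (simp_all only: integration_in_dual integration_add mult_free_Abelian_group)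

lemma subgroup_H1: "subgroup (H1 G) (chains1 G)"
proof (rule group.subgroupI[OF group_free_Abelian_group])
  have "0 \<in> H1 G"
    by (simp add: H1_iff bdry_def)
  then show "H1 G \<noteq> {}"
    by blast
qed (auto simp: H1_iff bdry_def frag_extend_add frag_extend_minus
       dest: subsetD[OF keys_add])

lemma subgroup_periods: "subgroup (periods G) (dual_group (harmonic G))"
proof -
  interpret group_hom "chains1 G" "dual_group (harmonic G)" "integration G"
    using comm_group_dual_group[OF group_harmonic, of G]
    by (simp add: group_hom_def group_hom_axioms_def comm_group_def integration_hom)
  show ?thesis
    unfolding periods_def by (rule subgroup_img_is_subgroup[OF subgroup_H1])
qed

lemma comm_group_Jacobian: "comm_group (Jacobian G)"
  unfolding Jacobian_def
  by (intro comm_group.abelian_FactGroup comm_group_dual_group group_harmonic subgroup_periods)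

lemma AJ_tilde_eq:
  assumes "\<gamma> \<in> carrier (chains1 G)" "bdry G \<gamma> = D"
  shows "AJ_tilde G D = periods G #>\<^bsub>dual_group (harmonic G)\<^esub> integration G \<gamma>"
proof -
  define \<delta> where "\<delta> = (SOME \<gamma>. \<gamma> \<in> carrier (chains1 G) \<and> bdry G \<gamma> = D)"
  have \<delta>: "\<delta> \<in> carrier (chains1 G)" "bdry G \<delta> = D"
    using someI[of "\<lambda>\<gamma>. \<gamma> \<in> carrier (chains1 G) \<and> bdry G \<gamma> = D" \<gamma>] assms
    unfolding \<delta>_def by blast+
  interpret comm_group "dual_group (harmonic G)"
    by (rule comm_group_dual_group[OF group_harmonic])
  have "\<gamma> - \<delta> \<in> H1 G"
    using assms \<delta> keys_diff[of \<gamma> \<delta>] by (auto simp: H1_iff bdry_def frag_extend_diff)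
  then have "integration G (\<gamma> - \<delta>) \<in> periods G"
    by (simp add: periods_def)
  then have "integration G \<gamma> \<in> periods G #>\<^bsub>dual_group (harmonic G)\<^esub> integration G \<delta>"
    unfolding r_coset_def using integration_add[of G "\<gamma> - \<delta>" \<delta>] by auto
  then have "periods G #>\<^bsub>dual_group (harmonic G)\<^esub> integration G \<delta>
      = periods G #>\<^bsub>dual_group (harmonic G)\<^esub> integration G \<gamma>"
    by (intro repr_independence integration_in_dual \<delta> subgroup_periods)
  then show ?thesis
    by (simp add: AJ_tilde_def \<delta>_def)
qed

end

theory Submission
  imports Defs
begin

text \<open>
  The proof rests on a family of integral unit flows \<open>P v\<close> from \<open>v\<close> to infinity (to a root, if the
  graph is finite) such that every edge is used by only finitely many \<open>P v\<close>. Then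
  \<open>x \<mapsto> x + (\<Sum>v. d\<^sup>*x(v) P v)\<close> is a retraction of \<open>\<int>\<^sup>E\<close> onto the harmonic cochains, so a
  functional on harmonic cochains extends to \<open>\<int>\<^sup>E\<close>, and by Specker's theorem it is integration
  along a finite chain: this is surjectivity. For the kernel, \<open>e + P (t e) - P (o e)\<close> is harmonic
  for every edge \<open>e\<close>, so a chain \<open>\<gamma>\<close> that vanishes on all harmonic cochains is \<open>\<partial>\<^sup>*\<close> of the
  finitely supported function \<open>v \<mapsto> - P v (\<gamma>)\<close>.
\<close>

subsection \<open>Specker's theorem\<close>

text \<open>Functionals act on all functions of the type, so no carrier conditions arise. Dependence
  on a subset of the coordinates is expressed by a separate hypothesis.\<close>

definition additive_int :: "(('a \<Rightarrow> int) \<Rightarrow> int) \<Rightarrow> bool" where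
  "additive_int \<phi> \<longleftrightarrow> (\<forall>x y. \<phi> (\<lambda>a. x a + y a) = \<phi> x + \<phi> y)"

lemma additive_int_add: "additive_int \<phi> \<Longrightarrow> \<phi> (\<lambda>a. x a + y a) = \<phi> x + \<phi> y"
  unfolding additive_int_def by blast

lemma additive_int_zero:
  assumes "additive_int \<phi>"
  shows "\<phi> (\<lambda>a. 0) = 0"
  using additive_int_add[OF assms, of "\<lambda>a. 0" "\<lambda>a. 0"] by simp

lemma additive_int_scale:
  assumes "additive_int \<phi>"
  shows "\<phi> (\<lambda>a. k * x a) = k * \<phi> x"
proof -
  have nat: "\<phi> (\<lambda>a. int n * x a) = int n * \<phi> x" for n
    by (induction n)
      (simp_all add: additive_int_zero[OF assms] additive_int_add[OF assms] distrib_right)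
  have "\<phi> (\<lambda>a. - y a) = - \<phi> y" for y
    using additive_int_add[OF assms, of y "\<lambda>a. - y a"] additive_int_zero[OF assms] by simp
  from this[of "\<lambda>a. int (nat (- k)) * x a"] show ?thesis
    using nat[of "nat k"] nat[of "nat (- k)"] by (cases "0 \<le> k") auto
qed

text \<open>Additivity allows only finitely many coordinates to be peeled off, so the tail stays as
  a term of its own.\<close>

lemma additive_int_split:
  fixes \<phi> :: "(nat \<Rightarrow> int) \<Rightarrow> int"
  assumes "additive_int \<phi>"
  shows "\<phi> x = (\<Sum>n<M. x n * \<phi> (\<lambda>k. of_bool (k = n))) + \<phi> (\<lambda>n. if n < M then 0 else x n)"
proof (induction M)
  case (Suc M)
  have "(\<lambda>n. if n < M then 0 else x n)
      = (\<lambda>n. x M * of_bool (n = M) + (if n < Suc M then 0 else x n))"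
    by (auto simp: fun_eq_iff less_Suc_eq)
  then have "\<phi> (\<lambda>n. if n < M then 0 else x n)
      = x M * \<phi> (\<lambda>n. of_bool (n = M)) + \<phi> (\<lambda>n. if n < Suc M then 0 else x n)"
    by (simp only: additive_int_add[OF assms] additive_int_scale[OF assms])
  with Suc show ?case
    by simp
qed simp

text \<open>The tail is \<open>d\<close> times an integer sequence, so its value is a multiple of
  \<open>d\<close>. Such congruences control the infinitely many remaining coordinates.\<close>

lemma additive_int_tail_dvd:
  fixes \<phi> :: "(nat \<Rightarrow> int) \<Rightarrow> int"
  assumes "additive_int \<phi>" and "\<And>n. n \<ge> M \<Longrightarrow> d dvd x n"
  shows "d dvd \<phi> x - (\<Sum>n<M. x n * \<phi> (\<lambda>k. of_bool (k = n)))"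
proof -
  have "(\<lambda>n. if n < M then 0 else x n) = (\<lambda>n. d * (if n < M then 0 else x n div d))"
    using assms(2) by (auto simp: fun_eq_iff)
  then have "\<phi> (\<lambda>n. if n < M then 0 else x n) = d * \<phi> (\<lambda>n. if n < M then 0 else x n div d)"
    by (simp only: additive_int_scale[OF assms(1)])
  then show ?thesis
    using additive_int_split[OF assms(1), of x M] by simp
qed

text \<open>
  Evaluate \<open>\<phi>\<close> on a sequence \<open>m\<close> with \<open>m n dvd m (n + 1)\<close> that grows faster than
  the partial sums \<open>s n = (\<Sum>i<n. m i * \<phi> (e i))\<close>. As \<open>m n\<close> divides \<open>\<phi> m - s n\<close>, the partial
  sums are eventually equal to \<open>\<phi> m\<close>.
\<close>

lemma additive_int_unit_vectors:
  fixes \<phi> :: "(nat \<Rightarrow> int) \<Rightarrow> int"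
  assumes add: "additive_int \<phi>"
  shows "\<exists>N. \<forall>n\<ge>N. \<phi> (\<lambda>k. of_bool (k = n)) = 0"
proof -
  define a where "a n = \<phi> (\<lambda>k. of_bool (k = n))" for n
  \<comment> \<open>The recursion is joint because the next modulus must exceed the next partial
    sum. The summand \<open>int n\<close> makes the moduli outgrow the constant
    \<open>\<phi> m\<close> as well.\<close>
  define p :: "nat \<Rightarrow> int \<times> int" where
    "p = rec_nat (1, 0) (\<lambda>n (m, s). (m * (\<bar>s + m * a n\<bar> + int n + 2), s + m * a n))"
  define m s where "m n = fst (p n)" and "s n = snd (p n)" for n
  have s0: "s 0 = 0" and m0: "m 0 = 1"
    by (simp_all add: s_def m_def p_def)
  have s_Suc: "s (Suc n) = s n + m n * a n"
    and m_Suc: "m (Suc n) = m n * (\<bar>s (Suc n)\<bar> + int n + 2)" for n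
    by (simp_all add: s_def m_def p_def split: prod.splits)
  have s: "s n = (\<Sum>i<n. m i * a i)" for n
    by (induction n) (simp_all add: s0 s_Suc)
  have m_pos: "m n \<ge> 1" for n
  proof (induction n)
    case (Suc n)
    then have "1 * 1 \<le> m n * (\<bar>s (Suc n)\<bar> + int n + 2)"
      by (intro mult_mono) auto
    then show ?case by (simp add: m_Suc)
  qed (simp add: m0)
  have big: "\<bar>s n\<bar> + int n < m n" for n
  proof (cases n)
    case (Suc i)
    have "1 * (\<bar>s (Suc i)\<bar> + int i + 2) \<le> m i * (\<bar>s (Suc i)\<bar> + int i + 2)"
      using m_pos by (intro mult_right_mono) auto
    then show ?thesis by (simp add: Suc m_Suc)
  qed (simp add: m0 s0)
  have "m n dvd m (n + k)" for n k
    by (induction k) (simp_all add: m_Suc)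
  then have "m n dvd m i" if "n \<le> i" for n i
    using that by (metis le_add_diff_inverse)
  then have dvd: "m n dvd \<phi> m - s n" for n
    using additive_int_tail_dvd[OF add, of n "m n" m] by (simp add: s a_def)
  have eq: "\<phi> m = s n" if "nat \<bar>\<phi> m\<bar> \<le> n" for n
  proof (rule ccontr)
    assume "\<phi> m \<noteq> s n"
    then have "m n \<le> \<bar>\<phi> m - s n\<bar>"
      using dvd_imp_le_int[OF _ dvd] m_pos[of n] by fastforce
    with big[of n] that show False by linarith
  qed
  \<comment> \<open>Two consecutive partial sums both equal \<open>\<phi> m\<close>, so their
    difference \<open>m n * a n\<close> vanishes.\<close>
  have "a n = 0" if "nat \<bar>\<phi> m\<bar> \<le> n" for n
    using eq[of n] eq[of "Suc n"] that s_Suc[of n] m_pos[of n] by simp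
  then show ?thesis
    unfolding a_def by blast
qed

lemma int_eq_0_if_powers_dvd:
  fixes q z :: int
  assumes "q \<ge> 2" and "\<And>n. n \<ge> N \<Longrightarrow> q ^ n dvd z"
  shows "z = 0"
proof (rule ccontr)
  assume "z \<noteq> 0"
  \<comment> \<open>An exponent of at least \<open>\<bar>z\<bar>\<close> suffices because
    \<open>n < 2 ^ n\<close>.\<close>
  let ?n = "max N (nat \<bar>z\<bar>)"
  have "q ^ ?n \<le> \<bar>z\<bar>"
    using dvd_imp_le_int[OF \<open>z \<noteq> 0\<close> assms(2)[of ?n]] assms(1) by simp
  moreover have "int ?n < 2 ^ ?n"
    by (metis of_nat_less_two_power)
  moreover have "(2::int) ^ ?n \<le> q ^ ?n"
    using assms(1) by (intro power_mono) auto
  ultimately show False by linarith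
qed

text \<open>
  Write \<open>x = y + z\<close> with \<open>2 ^ n dvd y n\<close> and \<open>3 ^ n dvd z n\<close>: on \<open>y\<close>, the error
  \<open>\<phi> y - (\<Sum>n<N. y n * a n)\<close> is divisible by all powers of \<open>2\<close>, and similarly on \<open>z\<close>.
\<close>

theorem Specker_nat:
  fixes \<phi> :: "(nat \<Rightarrow> int) \<Rightarrow> int"
  assumes add: "additive_int \<phi>"
  shows "\<exists>N a. \<forall>x. \<phi> x = (\<Sum>n<N. x n * a n)"
proof -
  define a where "a n = \<phi> (\<lambda>k. of_bool (k = n))" for n
  obtain N where N: "a n = 0" if "n \<ge> N" for n
    using additive_int_unit_vectors[OF add] unfolding a_def by blast
  have geometric: "\<phi> x = (\<Sum>n<N. x n * a n)" if "q \<ge> 2" and x: "\<And>n. q ^ n dvd x n" for q x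
  proof -
    \<comment> \<open>The coefficients vanish from \<open>N\<close> on, so all these powers divide
      one and the same error.\<close>
    have "q ^ M dvd \<phi> x - (\<Sum>n<N. x n * a n)" if "M \<ge> N" for M
    proof -
      have "(\<Sum>n<M. x n * a n) = (\<Sum>n<N. x n * a n)"
        by (rule sum.mono_neutral_right) (use that N in auto)
      moreover have "q ^ M dvd x n" if "n \<ge> M" for n
        using x that by (meson dvd_trans le_imp_power_dvd)
      ultimately show ?thesis
        using additive_int_tail_dvd[OF add, of M "q ^ M" x] by (simp add: a_def)
    qed
    then show ?thesis
      using int_eq_0_if_powers_dvd[OF that(1), of N "\<phi> x - (\<Sum>n<N. x n * a n)"] by simp
  qed
  have "\<phi> x = (\<Sum>n<N. x n * a n)" for x
  proof -
    \<comment> \<open>Bezout coefficients of \<open>2 ^ n\<close> and \<open>3 ^ n\<close> split any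
      integer into a multiple of each.\<close>
    have "\<exists>u v. u * 2 ^ n + v * 3 ^ n = (1::int)" for n
    proof -
      have "coprime (2 ^ n) (3 ^ n :: int)"
        by (intro coprime_power_left_iff[THEN iffD2] coprime_power_right_iff[THEN iffD2] disjI1) simp
      then show ?thesis
        using bezout_int[of "2 ^ n" "3 ^ n"] by (metis coprime_imp_gcd_eq_1)
    qed
    then obtain u v where uv: "u n * 2 ^ n + v n * 3 ^ n = (1::int)" for n
      by metis
    define y z where "y n = 2 ^ n * (u n * x n)" and "z n = 3 ^ n * (v n * x n)" for n
    have x: "x n = y n + z n" for n
    proof -
      have "y n + z n = (u n * 2 ^ n + v n * 3 ^ n) * x n"
        by (simp add: y_def z_def algebra_simps)
      then show ?thesis by (simp add: uv)
    qed
    have "\<phi> x = \<phi> y + \<phi> z"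
      unfolding additive_int_add[OF add, symmetric] x[symmetric] ..
    also have "\<dots> = (\<Sum>n<N. y n * a n) + (\<Sum>n<N. z n * a n)"
      using geometric[of 2 y] geometric[of 3 z] by (simp add: y_def z_def)
    finally show ?thesis
      by (simp add: x distrib_right sum.distrib)
  qed
  then show ?thesis by blast
qed

text \<open>An injection of \<open>A\<close> into the naturals transports \<open>\<phi>\<close> to
  sequences; by \<open>local\<close>, values off \<open>A\<close> do not affect it.\<close>

lemma Specker_countable:
  fixes \<phi> :: "('a \<Rightarrow> int) \<Rightarrow> int"
  assumes add: "additive_int \<phi>" and A: "countable A"
    and local: "\<And>x y. (\<And>a. a \<in> A \<Longrightarrow> x a = y a) \<Longrightarrow> \<phi> x = \<phi> y"
  shows "\<exists>F b. finite F \<and> F \<subseteq> A \<and> (\<forall>x. \<phi> x = (\<Sum>a\<in>F. b a * x a))"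
proof -
  let ?i = "to_nat_on A"
  have inj: "inj_on ?i A"
    using A by (rule inj_on_to_nat_on)
  have "additive_int (\<lambda>y. \<phi> (\<lambda>a. y (?i a)))"
    using add by (simp add: additive_int_def)
  then obtain N c where c: "\<phi> (\<lambda>a. y (?i a)) = (\<Sum>n<N. y n * c n)" for y
    using Specker_nat by blast
  define F where "F = {a \<in> A. ?i a < N}"
  have F: "finite F" "F \<subseteq> A" "inj_on ?i F"
    using inj by (auto simp: F_def intro: finite_imageD[OF finite_subset[of _ "{..<N}"]] inj_on_subset)
  have "\<phi> x = (\<Sum>a\<in>F. c (?i a) * x a)" for x
  proof -
    \<comment> \<open>Indices outside the range of the enumeration get the value 0, so the sum over
      \<open>n < N\<close> reduces to the image of \<open>F\<close>.\<close>
    define y where "y n = (if n \<in> ?i ` A then x (the_inv_into A ?i n) else 0)" for n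
    have y: "y (?i a) = x a" if "a \<in> A" for a
      using that by (simp add: y_def the_inv_into_f_f[OF inj])
    have "\<phi> x = \<phi> (\<lambda>a. y (?i a))"
      by (rule local) (simp add: y)
    also have "\<dots> = (\<Sum>n\<in>?i ` F. y n * c n)"
      unfolding c by (rule sum.mono_neutral_right) (auto simp: F_def y_def)
    also have "\<dots> = (\<Sum>a\<in>F. y (?i a) * c (?i a))"
      by (simp add: sum.reindex[OF F(3)])
    also have "\<dots> = (\<Sum>a\<in>F. c (?i a) * x a)"
      by (rule sum.cong) (use y F(2) in \<open>auto simp: mult.commute\<close>)
    finally show ?thesis .
  qed
  with F(1,2) show ?thesis
    by (intro exI[of _ F] exI[of _ "\<lambda>a. c (?i a)"]) simp
qed

subsection \<open>Chains and cochains of a locally finite graph\<close>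

lemma eval_chain_zero [simp]: "eval_chain \<omega> 0 = 0"
  by (simp add: eval_chain_def)

lemma eval_chain_frag_of [simp]: "eval_chain \<omega> (frag_of e) = \<omega> e"
  by (simp add: eval_chain_def)

lemma eval_chain_diff: "eval_chain \<omega> (\<gamma> - \<delta>) = eval_chain \<omega> \<gamma> - eval_chain \<omega> \<delta>"
  using eval_chain_add[of \<omega> \<gamma> "- \<delta>"] by (simp add: eval_chain_uminus)

lemma eval_chain_cmul: "eval_chain \<omega> (frag_cmul k \<gamma>) = k * eval_chain \<omega> \<gamma>"
  using eval_chain_superset[OF finite_keys keys_cmul, of \<omega> k \<gamma>]
  by (simp add: eval_chain_def sum_distrib_left mult.assoc)

lemma eval_chain_sum: "eval_chain \<omega> (\<Sum>i\<in>I. g i) = (\<Sum>i\<in>I. eval_chain \<omega> (g i))"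
  by (induction I rule: infinite_finite_induct) (simp_all add: eval_chain_add)

lemma eval_chain_cong:
  "(\<And>e. e \<in> Poly_Mapping.keys \<gamma> \<Longrightarrow> \<omega> e = \<eta> e) \<Longrightarrow> eval_chain \<omega> \<gamma> = eval_chain \<eta> \<gamma>"
  by (simp add: eval_chain_def)

lemma lookup_sum_frag_of:
  assumes "finite A"
  shows "Poly_Mapping.lookup (\<Sum>a\<in>A. frag_of a) e = of_bool (e \<in> A)"
  using assms by (simp add: lookup_sum)

lemma d_star_add:
  assumes "w \<in> verts G"
  shows "d_star G (\<lambda>e. x e + y e) w = d_star G x w + d_star G y w"
  using assms by (simp add: d_star_def sum.distrib)

lemma d_star_diff:
  assumes "w \<in> verts G"
  shows "d_star G (\<lambda>e. x e - y e) w = d_star G x w - d_star G y w"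
  using assms by (simp add: d_star_def sum_subtractf)

lemma d_star_sum:
  assumes "w \<in> verts G"
  shows "d_star G (\<lambda>e. \<Sum>i\<in>I. k i * x i e) w = (\<Sum>i\<in>I. k i * d_star G (x i) w)"
proof -
  have "d_star G (\<lambda>e. \<Sum>i\<in>I. k i * x i e) w
      = (\<Sum>i\<in>I. \<Sum>e\<in>in_arcs G w. k i * x i e) - (\<Sum>i\<in>I. \<Sum>e\<in>out_arcs G w. k i * x i e)"
    using assms by (simp add: d_star_def sum.swap[of _ I])
  then show ?thesis
    using assms by (simp add: d_star_def sum_subtractf right_diff_distrib sum_distrib_left)
qed

text \<open>Divergence at \<open>w\<close> sees only the edges at \<open>w\<close>. This is what
  allows a cochain given by an edgewise finite sum to be replaced, near a fixed vertex, by one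
  finite sum of cochains.\<close>

lemma d_star_cong:
  assumes "w \<in> verts G" and "\<And>e. e \<in> in_arcs G w \<union> out_arcs G w \<Longrightarrow> x e = y e"
  shows "d_star G x w = d_star G y w"
proof -
  have "sum x (in_arcs G w) = sum y (in_arcs G w)" "sum x (out_arcs G w) = sum y (out_arcs G w)"
    using assms(2) by (auto intro!: sum.cong)
  then show ?thesis by (simp add: d_star_def)
qed

lemma carrier_harmonic_iff:
  "\<omega> \<in> carrier (harmonic G) \<longleftrightarrow> \<omega> \<in> extensional (arcs G) \<and> (\<forall>v\<in>verts G. d_star G \<omega> v = 0)"
proof -
  have "d_star G \<omega> = (\<lambda>v\<in>verts G. 0) \<longleftrightarrow> (\<forall>v\<in>verts G. d_star G \<omega> v = 0)"
    unfolding d_star_def by (auto simp: fun_eq_iff restrict_def)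
  then show ?thesis
    by (simp add: harmonic_def kernel_def PiE_def)
qed

lemma restrict_in_harmonic:
  assumes "\<And>v. v \<in> verts G \<Longrightarrow> d_star G x v = 0"
  shows "restrict x (arcs G) \<in> carrier (harmonic G)"
proof -
  have "d_star G (restrict x (arcs G)) v = d_star G x v" if "v \<in> verts G" for v
    by (rule d_star_cong[OF that]) auto
  with assms show ?thesis
    by (simp add: carrier_harmonic_iff)
qed

lemma bdry_diff: "bdry G (\<gamma> - \<delta>) = bdry G \<gamma> - bdry G \<delta>"
  by (simp add: bdry_def frag_extend_diff)

lemma bdry_add: "bdry G (\<gamma> + \<delta>) = bdry G \<gamma> + bdry G \<delta>"
  by (simp add: bdry_def frag_extend_add)

lemma divisor_degree_eq_eval_chain: "divisor_degree D = eval_chain (\<lambda>_. 1) D"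
  by (simp add: divisor_degree_def eval_chain_def)

section \<open>Boundary operators and their adjoints on a connected locally finite graph\<close>

locale connected_locally_finite_graph = wf_digraph G for G :: "('v, 'e) pre_digraph" +
  assumes connected: "Digraph_Component.connected G"
    and locally_finite: "locally_finite G"
begin

lemma finite_incident [simp]:
  assumes "v \<in> verts G"
  shows "finite (in_arcs G v)" and "finite (out_arcs G v)"
  using assms locally_finite by (auto simp: locally_finite_def)

text \<open>A step in the symmetric closure is an arc traversed in either direction, hence the
  equivalence in the hypothesis on arcs.\<close>

lemma connected_induct [consumes 2, case_names base step]:
  assumes "u \<in> verts G" "v \<in> verts G" and "Q u"
    and "\<And>e. e \<in> arcs G \<Longrightarrow> Q (tail G e) \<longleftrightarrow> Q (head G e)"
  shows "Q v"
proof -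
  have "u \<rightarrow>\<^sup>*\<^bsub>with_proj (mk_symmetric G)\<^esub> v"
    using connected assms(1,2) by (auto simp: connected_def strongly_connected_def)
  then show ?thesis
    unfolding reachable_def
    by (induction rule: rtrancl_on_induct)
      (use assms(3,4) in \<open>auto simp: parcs_mk_symmetric\<close>)
qed

text \<open>Both sides are additive, and a single edge contributes 1 at its head and -1 at its tail.
  A chain with known boundary thus becomes a flow with known divergence.\<close>

lemma d_star_lookup:
  assumes "Poly_Mapping.keys \<gamma> \<subseteq> arcs G" and "w \<in> verts G"
  shows "d_star G (Poly_Mapping.lookup \<gamma>) w = Poly_Mapping.lookup (bdry G \<gamma>) w"
  using assms(1)
proof (induction \<gamma> rule: frag_induction)
  case (one e)
  with assms(2) show ?case
    by (auto simp: d_star_def bdry_def lookup_minus)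
next
  case (diff a b)
  with assms(2) show ?case
    by (simp add: bdry_diff lookup_minus d_star_def sum_subtractf)
qed (simp add: d_star_def bdry_def assms(2))

text \<open>On finitely supported functions \<open>bdry_star\<close> is the coboundary
  \<open>d\<close>; at a loop the two contributions cancel.\<close>

lemma lookup_bdry_star:
  assumes "Poly_Mapping.keys D \<subseteq> verts G"
  shows "Poly_Mapping.lookup (bdry_star G D) e
    = (if e \<in> arcs G then Poly_Mapping.lookup D (head G e) - Poly_Mapping.lookup D (tail G e) else 0)"
  using assms
proof (induction D rule: frag_induction)
  case (one v)
  then show ?case
    by (auto simp: bdry_star_def lookup_minus lookup_sum_frag_of)
next
  case (diff a b)
  then show ?case
    by (simp add: bdry_star_def frag_extend_diff lookup_minus)
qed (simp add: bdry_star_def)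

lemma keys_bdry_star:
  assumes "Poly_Mapping.keys D \<subseteq> verts G"
  shows "Poly_Mapping.keys (bdry_star G D) \<subseteq> arcs G"
  by (auto simp: in_keys_iff lookup_bdry_star[OF assms] split: if_splits)

lemma keys_bdry:
  assumes "Poly_Mapping.keys \<gamma> \<subseteq> arcs G"
  shows "Poly_Mapping.keys (bdry G \<gamma>) \<subseteq> verts G"
  using assms
proof (induction \<gamma> rule: frag_induction)
  case (one e)
  then show ?case
    using keys_diff[of "frag_of (head G e)" "frag_of (tail G e)"] by (auto simp: bdry_def)
next
  case (diff a b)
  then show ?case
    using keys_diff[of "bdry G a" "bdry G b"] by (auto simp: bdry_diff)
qed (simp add: bdry_def)

text \<open>\<open>bdry_star\<close> and \<open>d_star\<close> are adjoint: evaluating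
  \<open>\<omega>\<close> on \<open>bdry_star\<close> of a vertex gives the divergence
  there.\<close>

lemma eval_chain_bdry_star_harmonic:
  assumes "Poly_Mapping.keys D \<subseteq> verts G" and "\<omega> \<in> carrier (harmonic G)"
  shows "eval_chain \<omega> (bdry_star G D) = 0"
  using assms(1)
proof (induction D rule: frag_induction)
  case (one v)
  then have "eval_chain \<omega> (bdry_star G (frag_of v)) = d_star G \<omega> v"
    by (simp add: bdry_star_def d_star_def eval_chain_diff eval_chain_sum)
  with one assms(2) show ?case
    by (simp add: carrier_harmonic_iff)
next
  case (diff a b)
  then show ?case
    by (simp add: bdry_star_def frag_extend_diff eval_chain_diff)
qed (simp add: bdry_star_def)

lemma divisor_degree_bdry: "divisor_degree (bdry G \<gamma>) = 0"
  using subset_UNIV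
proof (induction \<gamma> rule: frag_induction)
  case (diff a b)
  then show ?case
    by (simp add: bdry_diff divisor_degree_eq_eval_chain eval_chain_diff)
qed (simp_all add: bdry_def divisor_degree_eq_eval_chain eval_chain_diff)

text \<open>Every edge enters exactly one vertex and leaves exactly one. The lemma removes the root
  term from the retraction when the graph is finite.\<close>

lemma sum_d_star_eq_0:
  assumes "finite (verts G)"
  shows "(\<Sum>v\<in>verts G. d_star G x v) = 0"
proof -
  have "arcs G = (\<Union>v\<in>verts G. in_arcs G v)"
    by auto
  then have fin: "finite (arcs G)"
    using assms by simp
  have "(\<Sum>v\<in>verts G. sum x (in_arcs G v)) = sum x (arcs G)"
    and "(\<Sum>v\<in>verts G. sum x (out_arcs G v)) = sum x (arcs G)"
    unfolding in_arcs_def out_arcs_def by (intro sum.group fin assms; auto)+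
  then show ?thesis
    by (simp add: d_star_def sum_subtractf)
qed

subsection \<open>Flows to infinity\<close>

text \<open>
  \<open>linked K u v\<close> expresses that \<open>u\<close> and \<open>v\<close> lie in the same component of \<open>G - K\<close>, with
  a path replaced by a \<open>1\<close>-chain with boundary \<open>v - u\<close>.
\<close>

definition linked :: "'v set \<Rightarrow> 'v \<Rightarrow> 'v \<Rightarrow> bool" where
  "linked K u v \<longleftrightarrow> (\<exists>\<gamma>. Poly_Mapping.keys \<gamma> \<subseteq> {e \<in> arcs G. tail G e \<notin> K \<and> head G e \<notin> K}
     \<and> bdry G \<gamma> = frag_of v - frag_of u)"

lemma linked_refl [simp]: "linked K u u"
  unfolding linked_def by (rule exI[of _ 0]) (simp add: bdry_def)

lemma linked_sym: "linked K u v \<Longrightarrow> linked K v u"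
proof -
  assume "linked K u v"
  then obtain \<gamma> where "Poly_Mapping.keys \<gamma> \<subseteq> {e \<in> arcs G. tail G e \<notin> K \<and> head G e \<notin> K}"
    "bdry G \<gamma> = frag_of v - frag_of u"
    unfolding linked_def by blast
  then show ?thesis
    unfolding linked_def by (intro exI[of _ "- \<gamma>"]) (simp add: bdry_def frag_extend_minus)
qed

lemma linked_trans: "linked K u v \<Longrightarrow> linked K v w \<Longrightarrow> linked K u w"
proof -
  assume "linked K u v" "linked K v w"
  then obtain \<gamma> \<delta> where
    "Poly_Mapping.keys \<gamma> \<subseteq> {e \<in> arcs G. tail G e \<notin> K \<and> head G e \<notin> K}"
    "Poly_Mapping.keys \<delta> \<subseteq> {e \<in> arcs G. tail G e \<notin> K \<and> head G e \<notin> K}"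
    "bdry G \<gamma> = frag_of v - frag_of u" "bdry G \<delta> = frag_of w - frag_of v"
    unfolding linked_def by blast
  then show ?thesis
    unfolding linked_def using keys_add[of \<gamma> \<delta>]
    by (intro exI[of _ "\<gamma> + \<delta>"]) (auto simp: bdry_add)
qed

lemma linked_arc:
  "e \<in> arcs G \<Longrightarrow> tail G e \<notin> K \<Longrightarrow> head G e \<notin> K \<Longrightarrow> linked K (tail G e) (head G e)"
  unfolding linked_def by (rule exI[of _ "frag_of e"]) (auto simp: bdry_def)

lemma linked_empty:
  assumes "u \<in> verts G" "v \<in> verts G"
  shows "linked {} u v"
  using assms
proof (induction rule: connected_induct)
  case (step e)
  then show ?case
    using linked_arc[of e "{}"] by (blast intro: linked_trans linked_sym)
qed simp

text \<open>Degree 0 is not preserved in an induction over \<open>D\<close>, so a multiple of a root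
  \<open>r\<close> is subtracted: a single vertex then reduces to a path from \<open>r\<close>, and
  for degree 0 the correction disappears.\<close>

lemma exists_chain_with_boundary:
  assumes "D \<in> carrier (Div0 G)"
  shows "\<exists>\<gamma>\<in>carrier (chains1 G). bdry G \<gamma> = D"
proof -
  obtain r where r: "r \<in> verts G"
    using connected by (auto simp: connected_def strongly_connected_def)
  have D: "Poly_Mapping.keys D \<subseteq> verts G" "divisor_degree D = 0"
    using assms by (auto simp: Div0_def)
  from D(1)
  have "\<exists>\<gamma>. Poly_Mapping.keys \<gamma> \<subseteq> arcs G
      \<and> bdry G \<gamma> = D - frag_cmul (divisor_degree D) (frag_of r)"
  proof (induction D rule: frag_induction)
    case zero
    show ?case
      by (rule exI[of _ 0]) (simp add: bdry_def divisor_degree_def)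
  next
    case (one v)
    then show ?case
      using linked_empty[OF r, of v] by (auto simp: linked_def divisor_degree_def)
  next
    case (diff a b)
    then obtain \<gamma> \<delta> where "Poly_Mapping.keys \<gamma> \<subseteq> arcs G" "Poly_Mapping.keys \<delta> \<subseteq> arcs G"
      "bdry G \<gamma> = a - frag_cmul (divisor_degree a) (frag_of r)"
      "bdry G \<delta> = b - frag_cmul (divisor_degree b) (frag_of r)"
      by blast
    then show ?case
      using keys_diff[of \<gamma> \<delta>]
      by (intro exI[of _ "\<gamma> - \<delta>"])
        (auto simp: bdry_diff divisor_degree_eq_eval_chain eval_chain_diff frag_cmul_diff_distrib)
  qed
  with D(2) show ?thesis
    by auto
qed

text \<open>If \<open>K\<close> is nonempty, every component of \<open>G - K\<close> meets the
  finite set \<open>B\<close> of neighbours of \<open>K\<close>, so the finite components are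
  finitely many. If \<open>K\<close> is empty, the only component is the whole infinite
  graph.\<close>

lemma finite_non_escaping:
  assumes "infinite (verts G)" and K: "finite K" "K \<subseteq> verts G"
  shows "finite {v \<in> verts G - K. finite {u \<in> verts G. linked K v u}}"
proof (cases "K = {}")
  case True
  have "{u \<in> verts G. linked {} v u} = verts G" if "v \<in> verts G" for v
    using linked_empty[OF that] by blast
  then have "{v \<in> verts G - K. finite {u \<in> verts G. linked K v u}} = {}"
    using assms(1) True by auto
  then show ?thesis
    by (simp only: finite.emptyI)
next
  case False
  then obtain k where k: "k \<in> K" by blast
  define B where "B = (\<Union>k\<in>K. head G ` out_arcs G k \<union> tail G ` in_arcs G k)"
  have B: "finite B"
    unfolding B_def using K by (intro finite_UN_I) auto
  \<comment> \<open>Propagation from \<open>k\<close>: an edge leaving \<open>K\<close> ends in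
    \<open>B\<close>, and an edge outside \<open>K\<close> extends a link.\<close>
  have near: "v \<in> K \<or> (\<exists>u\<in>B. linked K u v)" if "v \<in> verts G" for v
  proof -
    have "k \<in> verts G"
      using k K by blast
    from this that show ?thesis
    proof (induction rule: connected_induct)
      case (step e)
      have "head G e \<in> B" if "tail G e \<in> K"
        unfolding B_def using step that by force
      moreover have "tail G e \<in> B" if "head G e \<in> K"
        unfolding B_def using step that by force
      ultimately show ?case
        using linked_arc[OF step, of K] linked_refl
        by (cases "tail G e \<in> K"; cases "head G e \<in> K") (blast intro: linked_trans linked_sym)+
    qed (use k in blast)
  qed
  have "{v \<in> verts G - K. finite {u \<in> verts G. linked K v u}}
      \<subseteq> (\<Union>u\<in>{u \<in> B. finite {w \<in> verts G. linked K u w}}. {w \<in> verts G. linked K u w})"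
  proof
    fix v assume v: "v \<in> {v \<in> verts G - K. finite {u \<in> verts G. linked K v u}}"
    then obtain u where u: "u \<in> B" "linked K u v"
      using near by blast
    then have "{w \<in> verts G. linked K u w} = {w \<in> verts G. linked K v w}"
      by (blast intro: linked_trans linked_sym)
    with u v show "v \<in> (\<Union>u\<in>{u \<in> B. finite {w \<in> verts G. linked K u w}}. {w \<in> verts G. linked K u w})"
      by auto
  qed
  then show ?thesis
    by (rule finite_subset) (use B in auto)
qed

text \<open>
  \<open>P v\<close> is a unit flow from \<open>v\<close> to infinity, or to a fixed root if \<open>G\<close> is finite;
  \<open>c\<close> is then the indicator function of the root.
\<close>

definition escape_flows :: "('v \<Rightarrow> 'e \<Rightarrow> int) \<Rightarrow> ('v \<Rightarrow> int) \<Rightarrow> bool" where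
  "escape_flows P c \<longleftrightarrow>
     (\<forall>e\<in>arcs G. finite {v \<in> verts G. P v e \<noteq> 0})
   \<and> (\<forall>v\<in>verts G. \<forall>w\<in>verts G. d_star G (P v) w = c w - of_bool (v = w))
   \<and> (finite (verts G) \<or> (\<forall>w\<in>verts G. c w = 0))"

text \<open>Chains from each \<open>v\<close> to a root, read as cochains, are the flows; each edge
  is trivially used by finitely many of them.\<close>

lemma exists_escape_flows_finite:
  assumes "finite (verts G)"
  shows "\<exists>P c. escape_flows P c"
proof -
  obtain r where r: "r \<in> verts G"
    using connected by (auto simp: connected_def strongly_connected_def)
  have "\<exists>\<gamma>. Poly_Mapping.keys \<gamma> \<subseteq> arcs G \<and> bdry G \<gamma> = frag_of r - frag_of v" if "v \<in> verts G" for v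
    using linked_empty[OF that r] by (auto simp: linked_def)
  then obtain \<gamma> where \<gamma>: "Poly_Mapping.keys (\<gamma> v) \<subseteq> arcs G" "bdry G (\<gamma> v) = frag_of r - frag_of v"
    if "v \<in> verts G" for v
    by metis
  have "escape_flows (\<lambda>v. Poly_Mapping.lookup (\<gamma> v)) (\<lambda>w. of_bool (w = r))"
    using assms unfolding escape_flows_def
    by (auto simp: d_star_lookup \<gamma> lookup_minus)
  then show ?thesis by blast
qed

text \<open>
  Exhaust the vertices by finite sets \<open>K n\<close>, and let the level of \<open>v\<close> be the largest \<open>n\<close> such
  that the component of \<open>v\<close> in \<open>G - K n\<close> is infinite. As only finitely many vertices have a given
  level, \<open>v\<close> can be joined, outside \<open>K (level v)\<close>, to a vertex \<open>\<sigma> v\<close> of larger level. The flow \<open>P v\<close>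
  concatenates the paths from \<open>(\<sigma> ^^ k) v\<close> to \<open>(\<sigma> ^^ Suc k) v\<close>.
\<close>

lemma exists_escape_flows_infinite:
  assumes inf: "infinite (verts G)" and "countable (verts G)"
  shows "\<exists>P c. escape_flows P c"
proof -
  let ?i = "to_nat_on (verts G)"
  have inj: "inj_on ?i (verts G)"
    using assms(2) by (rule inj_on_to_nat_on)
  define K where "K n = {v \<in> verts G. ?i v < n}" for n
  have K: "finite (K n)" "K n \<subseteq> verts G" for n
    unfolding K_def using inj
    by (auto intro!: finite_imageD[OF finite_subset[of _ "{..<n}"]] elim: inj_on_subset)
  define escapes where "escapes n v \<longleftrightarrow> v \<notin> K n \<and> infinite {u \<in> verts G. linked (K n) v u}" for n v
  have fin_escapes: "finite {v \<in> verts G. \<not> escapes n v}" for n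
  proof -
    have "{v \<in> verts G. \<not> escapes n v}
        \<subseteq> K n \<union> {v \<in> verts G - K n. finite {u \<in> verts G. linked (K n) v u}}"
      by (auto simp: escapes_def)
    then show ?thesis
      using K finite_non_escaping[OF inf K] by (meson finite_UnI finite_subset)
  qed
  define level where "level v = Max {n. escapes n v}" for v
  have level: "escapes (level v) v" "\<And>n. escapes n v \<Longrightarrow> n \<le> level v" if "v \<in> verts G" for v
  proof -
    \<comment> \<open>The maximum exists: \<open>v\<close> lies in \<open>K n\<close> once
      \<open>n\<close> exceeds its index, while \<open>K 0\<close> is empty and so stage 0 always
      qualifies.\<close>
    have "{n. escapes n v} \<subseteq> {..?i v}"
      using that by (auto simp: escapes_def K_def)
    then have fin: "finite {n. escapes n v}"
      by (rule finite_subset) simp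
    have "{u \<in> verts G. linked {} v u} = verts G"
      using linked_empty[OF that] by blast
    then have "escapes 0 v"
      using inf by (simp add: escapes_def K_def)
    then show "escapes (level v) v" "\<And>n. escapes n v \<Longrightarrow> n \<le> level v"
      using fin Max_in[OF fin] Max_ge[OF fin] unfolding level_def by blast+
  qed
  have fin_level: "finite {v \<in> verts G. level v \<le> n}" for n
  proof (rule finite_subset[OF _ fin_escapes[of "Suc n"]])
    show "{v \<in> verts G. level v \<le> n} \<subseteq> {v \<in> verts G. \<not> escapes (Suc n) v}"
      using level(2) by fastforce
  qed
  define E where "E n = {e \<in> arcs G. tail G e \<notin> K n \<and> head G e \<notin> K n}" for n
  have "\<exists>u \<gamma>. u \<in> verts G \<and> level v < level u \<and> Poly_Mapping.keys \<gamma> \<subseteq> E (level v)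
      \<and> bdry G \<gamma> = frag_of u - frag_of v" if "v \<in> verts G" for v
  proof -
    have "infinite ({u \<in> verts G. linked (K (level v)) v u} - {u \<in> verts G. level u \<le> level v})"
      using level(1)[OF that] fin_level by (intro Diff_infinite_finite) (auto simp: escapes_def)
    then obtain u where "u \<in> verts G" "linked (K (level v)) v u" "level v < level u"
      by (metis (mono_tags, lifting) DiffD1 DiffD2 finite.emptyI linorder_not_le mem_Collect_eq ex_in_conv)
    then show ?thesis
      unfolding linked_def E_def by blast
  qed
  then obtain \<sigma> \<gamma> where \<sigma>: "\<sigma> v \<in> verts G" "level v < level (\<sigma> v)"
    and \<gamma>: "Poly_Mapping.keys (\<gamma> v) \<subseteq> E (level v)"
      "bdry G (\<gamma> v) = frag_of (\<sigma> v) - frag_of v" if "v \<in> verts G" for v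
    by metis
  have keys_\<gamma>: "Poly_Mapping.keys (\<gamma> v) \<subseteq> arcs G" if "v \<in> verts G" for v
    using \<gamma>(1)[OF that] by (auto simp: E_def)
  have orbit: "(\<sigma> ^^ k) v \<in> verts G \<and> level v + k \<le> level ((\<sigma> ^^ k) v)" if "v \<in> verts G" for k v
  proof (induction k)
    case (Suc k)
    then show ?case
      using \<sigma>[of "(\<sigma> ^^ k) v"] by auto
  qed (simp add: that)
  \<comment> \<open>The tail of such an edge lies in \<open>K (level v)\<close>, which the path
    \<open>\<gamma> v\<close> avoids.\<close>
  have vanish: "Poly_Mapping.lookup (\<gamma> v) e = 0" if "v \<in> verts G" "e \<in> arcs G" "?i (tail G e) < level v" for v e
    using \<gamma>(1)[OF that(1)] that by (auto simp: E_def K_def simp flip: not_in_keys_iff_lookup_eq_zero)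
  \<comment> \<open>The \<open>k\<close>-th path starts at level at least \<open>k\<close>, so it
    misses \<open>e\<close> as soon as \<open>k\<close> exceeds the index of the tail. The truncated
    sum is therefore the full concatenation, and any later cutoff gives the same value.\<close>
  define P where "P v e = (\<Sum>k\<le>?i (tail G e). Poly_Mapping.lookup (\<gamma> ((\<sigma> ^^ k) v)) e)" for v e
  have P_eq: "P v e = (\<Sum>k<N. Poly_Mapping.lookup (\<gamma> ((\<sigma> ^^ k) v)) e)"
    if "v \<in> verts G" "e \<in> arcs G" "?i (tail G e) < N" for v e N
    unfolding P_def
  proof (rule sum.mono_neutral_left)
    show "\<forall>k\<in>{..<N} - {..?i (tail G e)}. Poly_Mapping.lookup (\<gamma> ((\<sigma> ^^ k) v)) e = 0"
      using vanish orbit[OF that(1)] that(2) by (metis DiffD2 add_leD2 atMost_iff leI le_less_trans less_le_trans)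
  qed (use that in auto)
  have "finite {v \<in> verts G. P v e \<noteq> 0}" if "e \<in> arcs G" for e
  proof (rule finite_subset[OF _ fin_level[of "?i (tail G e)"]])
    have "P v e = 0" if v: "v \<in> verts G" "?i (tail G e) < level v" for v
      unfolding P_def
      using vanish[OF _ \<open>e \<in> arcs G\<close>] orbit[OF v(1)] v(2)
      by (intro sum.neutral) (metis add_leD1 less_le_trans)
    then show "{v \<in> verts G. P v e \<noteq> 0} \<subseteq> {v \<in> verts G. level v \<le> ?i (tail G e)}"
      by force
  qed
  moreover have "d_star G (P v) w = - of_bool (v = w)" if v: "v \<in> verts G" and w: "w \<in> verts G" for v w
  proof -
    \<comment> \<open>One cutoff \<open>N\<close> serves all edges at \<open>w\<close>. Including
      \<open>level w\<close> ensures that the end point \<open>(\<sigma> ^^ N) v\<close> of the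
      telescoping sum differs from \<open>w\<close>.\<close>
    let ?I = "insert (level w) ((\<lambda>e. ?i (tail G e)) ` (in_arcs G w \<union> out_arcs G w))"
    define N where "N = Suc (Max ?I)"
    have "n < N" if "n \<in> ?I" for n
      unfolding N_def using w that Max_ge[of ?I n] by (auto simp: less_Suc_eq_le)
    then have N: "level w < N" "\<And>e. e \<in> in_arcs G w \<union> out_arcs G w \<Longrightarrow> ?i (tail G e) < N"
      by blast+
    have "d_star G (P v) w = d_star G (\<lambda>e. \<Sum>k<N. 1 * Poly_Mapping.lookup (\<gamma> ((\<sigma> ^^ k) v)) e) w"
      by (rule d_star_cong[OF w]) (use N(2) P_eq[OF v] in auto)
    also have "\<dots> = (\<Sum>k<N. d_star G (Poly_Mapping.lookup (\<gamma> ((\<sigma> ^^ k) v))) w)"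
      unfolding d_star_sum[OF w] by simp
    also have "\<dots> = (\<Sum>k<N. of_bool ((\<sigma> ^^ Suc k) v = w) - of_bool ((\<sigma> ^^ k) v = w))"
      using orbit[OF v] by (intro sum.cong) (auto simp: d_star_lookup keys_\<gamma> \<gamma>(2) w lookup_minus)
    also have "\<dots> = of_bool ((\<sigma> ^^ N) v = w) - of_bool (v = w)"
      by (subst sum_lessThan_telescope) simp
    also have "\<dots> = - of_bool (v = w)"
      using orbit[OF v, of N] N(1) by auto
    finally show ?thesis .
  qed
  ultimately have "escape_flows P (\<lambda>_. 0)"
    by (simp add: escape_flows_def)
  then show ?thesis by blast
qed

subsection \<open>Harmonic cochains as a retract\<close>

lemma escape_flows_finite_support:
  assumes "escape_flows P c" "e \<in> arcs G"
  shows "finite {v \<in> verts G. P v e \<noteq> 0}"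
  using assms by (simp add: escape_flows_def)

lemma d_star_escape_flow:
  assumes "escape_flows P c" "v \<in> verts G" "w \<in> verts G"
  shows "d_star G (P v) w = c w - of_bool (v = w)"
  using assms by (simp add: escape_flows_def)

text \<open>The sum ranges over the support at \<open>e\<close> because a sum over an infinite index
  set would be 0 by convention.\<close>

definition harmonic_retract :: "('v \<Rightarrow> 'e \<Rightarrow> int) \<Rightarrow> ('e \<Rightarrow> int) \<Rightarrow> 'e \<Rightarrow> int" where
  "harmonic_retract P x =
     (\<lambda>e\<in>arcs G. x e + (\<Sum>u\<in>{u \<in> verts G. P u e \<noteq> 0}. d_star G x u * P u e))"

lemma harmonic_retract_id:
  assumes "\<omega> \<in> carrier (harmonic G)"
  shows "harmonic_retract P \<omega> = \<omega>"
proof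
  fix e
  have "(\<Sum>u\<in>{u \<in> verts G. P u e \<noteq> 0}. d_star G \<omega> u * P u e) = 0"
    by (rule sum.neutral) (use assms in \<open>auto simp: carrier_harmonic_iff\<close>)
  then show "harmonic_retract P \<omega> e = \<omega> e"
    using assms by (simp add: harmonic_retract_def carrier_harmonic_iff extensional_def)
qed

lemma harmonic_retract_add:
  "harmonic_retract P (\<lambda>e. x e + y e) = harmonic_retract P x \<otimes>\<^bsub>harmonic G\<^esub> harmonic_retract P y"
proof -
  have "(\<Sum>u\<in>{u \<in> verts G. P u e \<noteq> 0}. d_star G (\<lambda>e. x e + y e) u * P u e)
      = (\<Sum>u\<in>{u \<in> verts G. P u e \<noteq> 0}. d_star G x u * P u e)
        + (\<Sum>u\<in>{u \<in> verts G. P u e \<noteq> 0}. d_star G y u * P u e)" for e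
    unfolding sum.distrib[symmetric]
    by (rule sum.cong) (auto simp: d_star_add distrib_right)
  then show ?thesis
    by (auto simp: harmonic_retract_def harmonic_def fun_eq_iff)
qed

lemma harmonic_retract_cong:
  assumes "\<And>e. e \<in> arcs G \<Longrightarrow> x e = y e"
  shows "harmonic_retract P x = harmonic_retract P y"
proof -
  have "d_star G x u = d_star G y u" if "u \<in> verts G" for u
    by (rule d_star_cong[OF that]) (use assms in auto)
  with assms show ?thesis
    unfolding harmonic_retract_def by (auto simp: fun_eq_iff intro!: sum.cong)
qed

text \<open>At \<open>w\<close> the correction has divergence \<open>c w\<close> times the total
  divergence of \<open>x\<close>, minus \<open>d_star G x w\<close>. The first term vanishes because
  \<open>c\<close> is 0 on an infinite graph and the total is 0 on a finite one.\<close>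

lemma harmonic_retract_in_harmonic:
  assumes flows: "escape_flows P c"
  shows "harmonic_retract P x \<in> carrier (harmonic G)"
proof -
  let ?y = "\<lambda>e. x e + (\<Sum>u\<in>{u \<in> verts G. P u e \<noteq> 0}. d_star G x u * P u e)"
  have "d_star G ?y w = 0" if w: "w \<in> verts G" for w
  proof -
    \<comment> \<open>\<open>U\<close> contains every vertex whose flow touches an edge at
      \<open>w\<close>, and \<open>w\<close> itself for the cancellation. For a finite graph it is
      the whole vertex set, as the total divergence requires.\<close>
    define U where "U = (if finite (verts G) then verts G
      else insert w (\<Union>e\<in>in_arcs G w \<union> out_arcs G w. {u \<in> verts G. P u e \<noteq> 0}))"
    have U: "finite U" "w \<in> U" "U \<subseteq> verts G"
      and supp: "\<And>e u. e \<in> in_arcs G w \<union> out_arcs G w \<Longrightarrow> u \<in> verts G \<Longrightarrow> P u e \<noteq> 0 \<Longrightarrow> u \<in> U"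
      unfolding U_def using w escape_flows_finite_support[OF flows] by auto
    have "d_star G ?y w = d_star G (\<lambda>e. x e + (\<Sum>u\<in>U. d_star G x u * P u e)) w"
    proof (rule d_star_cong[OF w])
      fix e assume "e \<in> in_arcs G w \<union> out_arcs G w"
      then have "(\<Sum>u\<in>{u \<in> verts G. P u e \<noteq> 0}. d_star G x u * P u e) = (\<Sum>u\<in>U. d_star G x u * P u e)"
        by (intro sum.mono_neutral_left) (use U supp in auto)
      then show "?y e = x e + (\<Sum>u\<in>U. d_star G x u * P u e)"
        by simp
    qed
    also have "\<dots> = d_star G x w + (\<Sum>u\<in>U. d_star G x u * d_star G (P u) w)"
      by (simp only: d_star_add[OF w] d_star_sum[OF w])
    also have "(\<Sum>u\<in>U. d_star G x u * d_star G (P u) w)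
        = (\<Sum>u\<in>U. d_star G x u * c w - (if u = w then d_star G x u else 0))"
      by (rule sum.cong)
        (use U w in \<open>auto simp: d_star_escape_flow[OF flows] right_diff_distrib\<close>)
    also have "\<dots> = (\<Sum>u\<in>U. d_star G x u) * c w - d_star G x w"
      using U by (simp add: sum_subtractf sum_distrib_right)
    also have "(\<Sum>u\<in>U. d_star G x u) * c w = 0"
      using flows w sum_d_star_eq_0[of x] by (auto simp: escape_flows_def U_def)
    finally show ?thesis by simp
  qed
  then show ?thesis
    unfolding harmonic_retract_def by (rule restrict_in_harmonic)
qed

text \<open>Precomposing \<open>\<phi>\<close> with the retraction gives an additive functional of
  all cochains that depends on their values on \<open>arcs G\<close> only. Its finite coefficient
  vector is the required chain.\<close>

lemma integration_surj:
  assumes flows: "escape_flows P c" and "countable (arcs G)"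
    and \<phi>: "\<phi> \<in> carrier (dual_group (harmonic G))"
  shows "\<exists>\<gamma>\<in>carrier (chains1 G). integration G \<gamma> = \<phi>"
proof -
  have \<phi>_add: "\<phi> (\<omega> \<otimes>\<^bsub>harmonic G\<^esub> \<eta>) = \<phi> \<omega> + \<phi> \<eta>"
    if "\<omega> \<in> carrier (harmonic G)" "\<eta> \<in> carrier (harmonic G)" for \<omega> \<eta>
    using \<phi> that by (auto simp: dual_group_def hom_def)
  have "additive_int (\<lambda>x. \<phi> (harmonic_retract P x))"
    unfolding additive_int_def harmonic_retract_add
    by (simp add: \<phi>_add harmonic_retract_in_harmonic[OF flows])
  moreover have "\<phi> (harmonic_retract P x) = \<phi> (harmonic_retract P y)"
    if "\<And>e. e \<in> arcs G \<Longrightarrow> x e = y e" for x y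
    using harmonic_retract_cong[of x y P] that by simp
  ultimately obtain F b where F: "finite F" "F \<subseteq> arcs G"
    and b: "\<And>x. \<phi> (harmonic_retract P x) = (\<Sum>e\<in>F. b e * x e)"
    using Specker_countable[OF _ assms(2), of "\<lambda>x. \<phi> (harmonic_retract P x)"] by blast
  define \<gamma> where "\<gamma> = (\<Sum>e\<in>F. frag_cmul (b e) (frag_of e))"
  have "Poly_Mapping.keys \<gamma> \<subseteq> (\<Union>e\<in>F. Poly_Mapping.keys (frag_cmul (b e) (frag_of e)))"
    unfolding \<gamma>_def by (rule keys_sum)
  also have "\<dots> \<subseteq> arcs G"
    using F(2) by auto
  finally have "\<gamma> \<in> carrier (chains1 G)"
    by simp
  moreover have "integration G \<gamma> = \<phi>"
  proof
    fix \<omega>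
    show "integration G \<gamma> \<omega> = \<phi> \<omega>"
    proof (cases "\<omega> \<in> carrier (harmonic G)")
      case True
      then have "\<phi> \<omega> = (\<Sum>e\<in>F. b e * \<omega> e)"
        using b[of \<omega>] by (simp add: harmonic_retract_id)
      with True show ?thesis
        by (simp add: integration_def \<gamma>_def eval_chain_sum eval_chain_cmul)
    next
      case False
      with \<phi> show ?thesis
        by (simp add: integration_def dual_group_def extensional_def)
    qed
  qed
  ultimately show ?thesis by blast
qed

lemma annihilator_harmonic:
  assumes flows: "escape_flows P c" and \<gamma>: "Poly_Mapping.keys \<gamma> \<subseteq> arcs G"
    and zero: "\<And>\<omega>. \<omega> \<in> carrier (harmonic G) \<Longrightarrow> eval_chain \<omega> \<gamma> = 0"
  shows "\<exists>D\<in>carrier (chains0 G). bdry_star G D = \<gamma>"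
proof -
  let ?f = "\<lambda>v. - eval_chain (P v) \<gamma>"
  define W where "W = {v \<in> verts G. ?f v \<noteq> 0}"
  have "W \<subseteq> (\<Union>e\<in>Poly_Mapping.keys \<gamma>. {v \<in> verts G. P v e \<noteq> 0})"
  proof
    fix v assume "v \<in> W"
    then have "v \<in> verts G" "\<exists>e\<in>Poly_Mapping.keys \<gamma>. Poly_Mapping.lookup \<gamma> e * P v e \<noteq> 0"
      unfolding W_def eval_chain_def by (auto intro: sum.neutral)
    then show "v \<in> (\<Union>e\<in>Poly_Mapping.keys \<gamma>. {v \<in> verts G. P v e \<noteq> 0})"
      by auto
  qed
  moreover have "finite (\<Union>e\<in>Poly_Mapping.keys \<gamma>. {v \<in> verts G. P v e \<noteq> 0})"
    using escape_flows_finite_support[OF flows] \<gamma> by auto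
  ultimately have W: "finite W"
    by (rule finite_subset)
  define D where "D = (\<Sum>v\<in>W. frag_cmul (?f v) (frag_of v))"
  have lookup_D: "Poly_Mapping.lookup D v = ?f v" if "v \<in> verts G" for v
    using W that by (auto simp: D_def lookup_sum W_def if_distrib cong: if_cong)
  have "Poly_Mapping.keys D \<subseteq> (\<Union>v\<in>W. Poly_Mapping.keys (frag_cmul (?f v) (frag_of v)))"
    unfolding D_def by (rule keys_sum)
  also have "\<dots> \<subseteq> verts G"
    by (auto simp: W_def)
  finally have D: "Poly_Mapping.keys D \<subseteq> verts G" .
  have "Poly_Mapping.lookup (bdry_star G D) e = Poly_Mapping.lookup \<gamma> e" for e
  proof (cases "e \<in> arcs G")
    case True
    \<comment> \<open>The divergences of the edge and of the two flows cancel; \<open>c\<close>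
      drops out of the difference. Vanishing on \<open>\<gamma>\<close> then says that its
      coefficient at \<open>e\<close> is \<open>?f (head G e) - ?f (tail G e)\<close>.\<close>
    let ?\<omega> = "\<lambda>a. of_bool (a = e) + (P (head G e) a - P (tail G e) a)"
    have "d_star G (\<lambda>a. of_bool (a = e)) w = of_bool (head G e = w) - of_bool (tail G e = w)"
      if "w \<in> verts G" for w
      using that True by (auto simp: d_star_def of_bool_def)
    then have "d_star G ?\<omega> w = 0" if "w \<in> verts G" for w
      using that True by (simp add: d_star_add d_star_diff d_star_escape_flow[OF flows])
    then have "eval_chain (restrict ?\<omega> (arcs G)) \<gamma> = 0"
      by (intro zero restrict_in_harmonic)
    moreover have "eval_chain (restrict ?\<omega> (arcs G)) \<gamma> = eval_chain ?\<omega> \<gamma>"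
      using \<gamma> by (intro eval_chain_cong) auto
    moreover have "eval_chain ?\<omega> \<gamma> = eval_chain (\<lambda>a. of_bool (a = e)) \<gamma>
        + (eval_chain (P (head G e)) \<gamma> - eval_chain (P (tail G e)) \<gamma>)"
      by (simp add: eval_chain_def sum.distrib sum_subtractf distrib_left right_diff_distrib)
    moreover have "eval_chain (\<lambda>a. of_bool (a = e)) \<gamma> = Poly_Mapping.lookup \<gamma> e"
      by (auto simp: eval_chain_def of_bool_def if_distrib in_keys_iff cong: if_cong)
    ultimately show ?thesis
      using True by (simp add: lookup_bdry_star[OF D] lookup_D)
  next
    case False
    with \<gamma> show ?thesis
      by (auto simp: lookup_bdry_star[OF D] simp flip: not_in_keys_iff_lookup_eq_zero)
  qed
  then have "bdry_star G D = \<gamma>"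
    by (rule poly_mapping_eqI)
  with D show ?thesis by auto
qed

subsection \<open>The Abel--Jacobi map\<close>

lemma Prin_subset_Div0: "Prin G \<subseteq> carrier (Div0 G)"
  by (auto simp: Prin_def laplacian0_def Div0_def divisor_degree_bdry
      dest: subsetD[OF keys_bdry[OF keys_bdry_star]])

lemma bdry_in_Div0: "\<gamma> \<in> carrier (chains1 G) \<Longrightarrow> bdry G \<gamma> \<in> carrier (Div0 G)"
  by (auto simp: Div0_def divisor_degree_bdry dest: subsetD[OF keys_bdry])

lemma group_Div0: "Group.group (Div0 G)"
  unfolding Div0_def
proof (rule subgroup.subgroup_is_group[OF group.subgroupI])
  have "0 \<in> {D \<in> carrier (chains0 G). divisor_degree D = 0}"
    by (simp add: divisor_degree_def)
  then show "{D \<in> carrier (chains0 G). divisor_degree D = 0} \<noteq> {}"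
    by blast
qed (auto simp: divisor_degree_eq_eval_chain eval_chain_add eval_chain_uminus
       dest: subsetD[OF keys_add])

lemma AJ_tilde_hom: "AJ_tilde G \<in> hom (Div0 G) (Jacobian G)"
proof (rule homI)
  let ?M = "dual_group (harmonic G)"
  interpret M: comm_group ?M
    by (rule comm_group_dual_group[OF group_harmonic])
  interpret N: normal "periods G" ?M
    by (rule M.subgroup_imp_normal[OF subgroup_periods])
  fix D assume "D \<in> carrier (Div0 G)"
  then obtain \<gamma> where \<gamma>: "\<gamma> \<in> carrier (chains1 G)" "bdry G \<gamma> = D"
    using exists_chain_with_boundary by blast
  show "AJ_tilde G D \<in> carrier (Jacobian G)"
    unfolding AJ_tilde_eq[OF \<gamma>] Jacobian_def carrier_FactGroup
    using integration_in_dual[OF \<gamma>(1)] by blast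
  fix D' assume "D' \<in> carrier (Div0 G)"
  then obtain \<delta> where \<delta>: "\<delta> \<in> carrier (chains1 G)" "bdry G \<delta> = D'"
    using exists_chain_with_boundary by blast
  have "\<gamma> + \<delta> \<in> carrier (chains1 G)"
    using \<gamma>(1) \<delta>(1) keys_add[of \<gamma> \<delta>] by auto
  then have "AJ_tilde G (D + D') = periods G #>\<^bsub>?M\<^esub> integration G (\<gamma> + \<delta>)"
    by (rule AJ_tilde_eq) (simp add: bdry_add \<gamma> \<delta>)
  also have "\<dots> = AJ_tilde G D <#>\<^bsub>?M\<^esub> AJ_tilde G D'"
    unfolding AJ_tilde_eq[OF \<gamma>] AJ_tilde_eq[OF \<delta>] integration_add
    using \<gamma>(1) \<delta>(1) by (intro N.rcos_sum[symmetric] integration_in_dual)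
  finally show "AJ_tilde G (D \<otimes>\<^bsub>Div0 G\<^esub> D') = AJ_tilde G D \<otimes>\<^bsub>Jacobian G\<^esub> AJ_tilde G D'"
    by (simp add: Div0_def Jacobian_def FactGroup_def)
qed

lemma AJ_tilde_surj:
  assumes "escape_flows P c" and "countable (arcs G)"
  shows "AJ_tilde G ` carrier (Div0 G) = carrier (Jacobian G)"
proof
  show "AJ_tilde G ` carrier (Div0 G) \<subseteq> carrier (Jacobian G)"
    using AJ_tilde_hom by (auto simp: hom_def)
  show "carrier (Jacobian G) \<subseteq> AJ_tilde G ` carrier (Div0 G)"
  proof
    fix X assume "X \<in> carrier (Jacobian G)"
    then obtain \<phi> where \<phi>: "\<phi> \<in> carrier (dual_group (harmonic G))"
      and X: "X = periods G #>\<^bsub>dual_group (harmonic G)\<^esub> \<phi>"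
      unfolding Jacobian_def carrier_FactGroup by blast
    obtain \<gamma> where \<gamma>: "\<gamma> \<in> carrier (chains1 G)" "integration G \<gamma> = \<phi>"
      using integration_surj[OF assms \<phi>] by blast
    then have "X = AJ_tilde G (bdry G \<gamma>)"
      using X AJ_tilde_eq[OF \<gamma>(1) refl] by simp
    then show "X \<in> AJ_tilde G ` carrier (Div0 G)"
      using bdry_in_Div0[OF \<gamma>(1)] by blast
  qed
qed

text \<open>If the class is trivial, a chain \<open>\<gamma>\<close> bounding \<open>D\<close>
  integrates like a cycle \<open>\<delta>\<close>, so \<open>\<gamma> - \<delta>\<close> annihilates
  the harmonic cochains and lies in the image of \<open>bdry_star\<close>, with boundary still
  \<open>D\<close>. Conversely, \<open>bdry_star G F\<close> bounds a principal divisor and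
  integrates to 0.\<close>

lemma kernel_AJ_tilde:
  assumes flows: "escape_flows P c"
  shows "kernel (Div0 G) (Jacobian G) (AJ_tilde G) = Prin G"
proof
  let ?M = "dual_group (harmonic G)"
  interpret M: comm_group ?M
    by (rule comm_group_dual_group[OF group_harmonic])
  have one: "\<one>\<^bsub>Jacobian G\<^esub> = periods G"
    by (simp add: Jacobian_def FactGroup_def)
  show "kernel (Div0 G) (Jacobian G) (AJ_tilde G) \<subseteq> Prin G"
  proof
    fix D assume "D \<in> kernel (Div0 G) (Jacobian G) (AJ_tilde G)"
    then have D: "D \<in> carrier (Div0 G)" "AJ_tilde G D = periods G"
      by (auto simp: kernel_def one)
    obtain \<gamma> where \<gamma>: "\<gamma> \<in> carrier (chains1 G)" "bdry G \<gamma> = D"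
      using exists_chain_with_boundary[OF D(1)] by blast
    have "integration G \<gamma> \<in> periods G"
      using M.rcos_self[OF integration_in_dual[OF \<gamma>(1)] subgroup_periods]
        AJ_tilde_eq[OF \<gamma>] D(2) by simp
    then obtain \<delta> where \<delta>: "\<delta> \<in> H1 G" "integration G \<gamma> = integration G \<delta>"
      by (auto simp: periods_def)
    have "eval_chain \<omega> (\<gamma> - \<delta>) = 0" if "\<omega> \<in> carrier (harmonic G)" for \<omega>
      using fun_cong[OF \<delta>(2), of \<omega>] that by (simp add: integration_def eval_chain_diff)
    moreover have "Poly_Mapping.keys (\<gamma> - \<delta>) \<subseteq> arcs G"
      using \<gamma>(1) \<delta>(1) keys_diff[of \<gamma> \<delta>] by (auto simp: H1_iff)
    ultimately obtain F where "F \<in> carrier (chains0 G)" "bdry_star G F = \<gamma> - \<delta>"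
      using annihilator_harmonic[OF flows, of "\<gamma> - \<delta>"] by blast
    moreover have "bdry G (\<gamma> - \<delta>) = D"
      using \<gamma> \<delta>(1) by (simp add: bdry_diff H1_iff)
    ultimately show "D \<in> Prin G"
      unfolding Prin_def laplacian0_def by force
  qed
  show "Prin G \<subseteq> kernel (Div0 G) (Jacobian G) (AJ_tilde G)"
  proof
    fix D assume D: "D \<in> Prin G"
    then obtain F where F: "Poly_Mapping.keys F \<subseteq> verts G" "D = bdry G (bdry_star G F)"
      by (auto simp: Prin_def laplacian0_def)
    have "bdry_star G F \<in> carrier (chains1 G)"
      using keys_bdry_star[OF F(1)] by simp
    then have "AJ_tilde G D = periods G #>\<^bsub>?M\<^esub> integration G (bdry_star G F)"
      by (rule AJ_tilde_eq) (simp add: F(2))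
    also have "integration G (bdry_star G F) = \<one>\<^bsub>?M\<^esub>"
      using eval_chain_bdry_star_harmonic[OF F(1)]
      by (auto simp: integration_def dual_group_def fun_eq_iff)
    also have "periods G #>\<^bsub>?M\<^esub> \<one>\<^bsub>?M\<^esub> = periods G"
      using subgroup.subset[OF subgroup_periods] by (rule M.coset_mult_one)
    finally show "D \<in> kernel (Div0 G) (Jacobian G) (AJ_tilde G)"
      using D Prin_subset_Div0 by (auto simp: kernel_def one)
  qed
qed

end

theorem theorem2p3p10:
  fixes G :: "('v, 'e) pre_digraph"
  assumes "wf_digraph G"
    and "Digraph_Component.connected G"
    and "locally_finite G"
    and "countable (verts G)" and "countable (arcs G)"
  shows "AJ_tilde G \<in> epi (Div0 G) (Jacobian G)
    \<and> kernel (Div0 G) (Jacobian G) (AJ_tilde G) = Prin G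
    \<and> AJ G \<in> iso (Cl0 G) (Jacobian G)"
proof -
  interpret connected_locally_finite_graph G
    using assms(1-3)
    by (simp add: connected_locally_finite_graph_def connected_locally_finite_graph_axioms_def)
  obtain P c where flows: "escape_flows P c"
    using exists_escape_flows_finite exists_escape_flows_infinite[OF _ assms(4)] by blast
  interpret AJ: group_hom "Div0 G" "Jacobian G" "AJ_tilde G"
    using group_Div0 comm_group_Jacobian[of G] AJ_tilde_hom
    by (simp add: group_hom_def group_hom_axioms_def comm_group_def)
  note surj = AJ_tilde_surj[OF flows assms(5)] and ker = kernel_AJ_tilde[OF flows]
  \<comment> \<open>First isomorphism theorem, with \<open>AJ\<close> as the map induced on cosets
    of the kernel.\<close>
  have "AJ G \<in> iso (Cl0 G) (Jacobian G)"
    using AJ.FactGroup_iso_set[OF surj] by (simp add: ker Cl0_def AJ_def[abs_def])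
  with surj ker AJ_tilde_hom show ?thesis
    by (simp add: epi_def)
qed

end
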